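(* Let $\mathcal{C}$ be a Ramsey class of $\mathcal{L}'$-structures and $\mathcal{N}$ an $\mathcal{L}'$-structure such that $\mathrm{Age}(\mathcal{N})=\mathcal{C}$. Then there is an $\mathrm{Aut}(\mathcal{N})$-invariant linear order on $\mathcal{N}$ which is a union of quantifier-free types. More explicitly, there is a (possibly infinite) Boolean combination of atomic and negated atomic $\mathcal{L}'$-formulas $\Phi(x,y):=\bigvee_{i\in I}\bigwedge_{j\in J_i}\varphi_{i,j}(x,y)$, with each $\varphi_{i,j}$ an atomic or negated atomic $\mathcal{L}'$-formula (the index sets $I,J_i$ being arbitrary, possibly infinite), such that $\Phi$ defines a linear order on every structure in $\mathcal{C}$.
   Context: $\mathcal{L}'$ is a first-order language. $\mathrm{Age}(\mathcal{N})$ is the class of (isomorphism types of) finitely generated substructures of $\mathcal{N}$; it is treated as an isomorphism-closed class. For structures $A,C$, $\binom{C}{A}$ is the set of embeddings $A\to C$. For $A\subseteq B$, write $C\to(B)^A_2$ if for every colouring $\chi:\binom{C}{A}\to\{0,1\}$ there is an embedding $e:B\to C$ such that $\chi$ is constant on $\{e\circ f: f\in\binom{B}{A}\}$. A class $\mathcal{C}$ has HP if it is closed under substructures; JEP if any two members embed in a common member; ERP if for all $A\subseteq B$ in $\mathcal{C}$ there is $C\in\mathcal{C}$ with $C\to(B)^A_2$. A Ramsey class is an isomorphism-closed class of finite structures with HP, JEP and ERP. A binary relation on $\mathcal{N}$ is a union of quantifier-free types if it is a union of sets of realisations in $\mathcal{N}$ of complete quantifier-free types (over $\emptyset$) in two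 variables. *)

theory Defs
  imports Main "HOL.Hull" "HOL-Library.FuncSet"
begin

section \<open>Languages and structures\<close>

text \<open>The symbols are carried by sets rather than types, so that a language may, for instance,
  have no function symbols. Constants are function symbols of arity 0.\<close>

record ('f, 'r) language =
  Funs :: "'f set"
  Rels :: "'r set"
  farity :: "'f \<Rightarrow> nat"
  rarity :: "'r \<Rightarrow> nat"

text \<open>The interpretations are only meaningful on symbols of the language and on tuples of the right
  length from the universe; every notion below ignores their other values. Empty universes are
  permitted.\<close>

record ('a, 'f, 'r) struct =
  univ :: "'a set"
  funI :: "'f \<Rightarrow> 'a list \<Rightarrow> 'a"
  relI :: "'r \<Rightarrow> 'a list \<Rightarrow> bool"

definition tuples :: "'a set \<Rightarrow> nat \<Rightarrow> 'a list set" where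
  "tuples U n = {xs \<in> lists U. length xs = n}"

definition subuniverse :: "('f, 'r) language \<Rightarrow> ('a, 'f, 'r) struct \<Rightarrow> 'a set \<Rightarrow> bool" where
  "subuniverse L M U \<longleftrightarrow>
     U \<subseteq> univ M \<and> (\<forall>f\<in>Funs L. \<forall>xs\<in>tuples U (farity L f). funI M f xs \<in> U)"

definition is_structure :: "('f, 'r) language \<Rightarrow> ('a, 'f, 'r) struct \<Rightarrow> bool" where
  "is_structure L M \<longleftrightarrow> subuniverse L M (univ M)"

definition substructure ::
    "('f, 'r) language \<Rightarrow> ('a, 'f, 'r) struct \<Rightarrow> ('a, 'f, 'r) struct \<Rightarrow> bool" where
  "substructure L A B \<longleftrightarrow>
     is_structure L A \<and> is_structure L B \<and> univ A \<subseteq> univ B \<and>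
     (\<forall>f\<in>Funs L. \<forall>xs\<in>tuples (univ A) (farity L f). funI A f xs = funI B f xs) \<and>
     (\<forall>r\<in>Rels L. \<forall>xs\<in>tuples (univ A) (rarity L r). relI A r xs = relI B r xs)"

definition finitely_generated :: "('f, 'r) language \<Rightarrow> ('a, 'f, 'r) struct \<Rightarrow> bool" where
  "finitely_generated L A \<longleftrightarrow>
     (\<exists>X. finite X \<and> X \<subseteq> univ A \<and> subuniverse L A hull X = univ A)"

text \<open>Embeddings are extensional, so that two embeddings are equal precisely when they agree on the
  universe of their domain; otherwise colourings could distinguish values outside it.\<close>

definition embeddings ::
    "('f, 'r) language \<Rightarrow> ('a, 'f, 'r) struct \<Rightarrow> ('b, 'f, 'r) struct \<Rightarrow> ('a \<Rightarrow> 'b) set" where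
  "embeddings L A B = {e \<in> univ A \<rightarrow>\<^sub>E univ B. inj_on e (univ A) \<and>
     (\<forall>f\<in>Funs L. \<forall>xs\<in>tuples (univ A) (farity L f). e (funI A f xs) = funI B f (map e xs)) \<and>
     (\<forall>r\<in>Rels L. \<forall>xs\<in>tuples (univ A) (rarity L r). relI A r xs = relI B r (map e xs))}"

definition isomorphisms ::
    "('f, 'r) language \<Rightarrow> ('a, 'f, 'r) struct \<Rightarrow> ('b, 'f, 'r) struct \<Rightarrow> ('a \<Rightarrow> 'b) set" where
  "isomorphisms L A B = {e \<in> embeddings L A B. e ` univ A = univ B}"

definition isomorphic ::
    "('f, 'r) language \<Rightarrow> ('a, 'f, 'r) struct \<Rightarrow> ('b, 'f, 'r) struct \<Rightarrow> bool" where
  "isomorphic L A B \<longleftrightarrow> isomorphisms L A B \<noteq> {}"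

abbreviation Aut :: "('f, 'r) language \<Rightarrow> ('a, 'f, 'r) struct \<Rightarrow> ('a \<Rightarrow> 'a) set" where
  "Aut L M \<equiv> isomorphisms L M M"

definition aut_invariant ::
    "('f, 'r) language \<Rightarrow> ('a, 'f, 'r) struct \<Rightarrow> ('a \<times> 'a) set \<Rightarrow> bool" where
  "aut_invariant L M R \<longleftrightarrow>
     (\<forall>g\<in>Aut L M. \<forall>a\<in>univ M. \<forall>b\<in>univ M. (a, b) \<in> R \<longleftrightarrow> (g a, g b) \<in> R)"


section \<open>Ramsey classes and ages\<close>

text \<open>An isomorphism-closed class of finite structures is determined by those of its members whose
  universe is a set of natural numbers, so such classes are represented by sets of structures on
  \<^typ>\<open>nat\<close>.\<close>

type_synonym ('f, 'r) struct_class = "(nat, 'f, 'r) struct set"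

definition iso_closed :: "('f, 'r) language \<Rightarrow> ('f, 'r) struct_class \<Rightarrow> bool" where
  "iso_closed L C \<longleftrightarrow> (\<forall>A\<in>C. \<forall>B. is_structure L B \<and> isomorphic L A B \<longrightarrow> B \<in> C)"

definition HP :: "('f, 'r) language \<Rightarrow> ('f, 'r) struct_class \<Rightarrow> bool" where
  "HP L C \<longleftrightarrow> (\<forall>B\<in>C. \<forall>A. substructure L A B \<longrightarrow> A \<in> C)"

definition JEP :: "('f, 'r) language \<Rightarrow> ('f, 'r) struct_class \<Rightarrow> bool" where
  "JEP L C \<longleftrightarrow>
     (\<forall>A\<in>C. \<forall>B\<in>C. \<exists>D\<in>C. embeddings L A D \<noteq> {} \<and> embeddings L B D \<noteq> {})"

text \<open>The partition relation \<open>D \<rightarrow> (B)\<^sup>A\<^sub>2\<close>.\<close>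

definition ramsey_arrow ::
    "('f, 'r) language \<Rightarrow> ('d, 'f, 'r) struct \<Rightarrow> ('b, 'f, 'r) struct \<Rightarrow> ('a, 'f, 'r) struct \<Rightarrow> bool" where
  "ramsey_arrow L D B A \<longleftrightarrow>
     (\<forall>\<chi> \<in> embeddings L A D \<rightarrow> {0, 1::nat}. \<exists>e\<in>embeddings L B D. \<exists>c.
        \<forall>f\<in>embeddings L A B. \<chi> (compose (univ A) e f) = c)"

definition ERP :: "('f, 'r) language \<Rightarrow> ('f, 'r) struct_class \<Rightarrow> bool" where
  "ERP L C \<longleftrightarrow> (\<forall>A\<in>C. \<forall>B\<in>C. substructure L A B \<longrightarrow> (\<exists>D\<in>C. ramsey_arrow L D B A))"

definition ramsey_class :: "('f, 'r) language \<Rightarrow> ('f, 'r) struct_class \<Rightarrow> bool" where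
  "ramsey_class L C \<longleftrightarrow>
     (\<forall>A\<in>C. is_structure L A \<and> finite (univ A)) \<and>
     iso_closed L C \<and> HP L C \<and> JEP L C \<and> ERP L C"

text \<open>Equality of the isomorphism-closed class \<open>Age(N)\<close> with the isomorphism-closed class
  represented by \<open>C\<close>. It is stated as two inclusions up to isomorphism because the finitely
  generated substructures of \<open>N\<close> live on another type; the first one also rules out finitely
  generated substructures without a copy on \<^typ>\<open>nat\<close>.\<close>

definition has_age ::
    "('f, 'r) language \<Rightarrow> ('a, 'f, 'r) struct \<Rightarrow> ('f, 'r) struct_class \<Rightarrow> bool" where
  "has_age L N C \<longleftrightarrow>
     (\<forall>A. substructure L A N \<and> finitely_generated L A \<longrightarrow> (\<exists>B\<in>C. isomorphic L A B)) \<and>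
     (\<forall>B\<in>C. \<exists>A. substructure L A N \<and> finitely_generated L A \<and> isomorphic L A B)"


section \<open>Quantifier-free formulas and types in two variables\<close>

datatype ('f, 'v) tm = Var 'v | App 'f "('f, 'v) tm list"

datatype ('f, 'r, 'v) atom = Eq "('f, 'v) tm" "('f, 'v) tm" | Rel 'r "('f, 'v) tm list"

datatype ('f, 'r, 'v) qf =
    Atom "('f, 'r, 'v) atom"
  | Neg "('f, 'r, 'v) qf"
  | Conj "('f, 'r, 'v) qf" "('f, 'r, 'v) qf"
  | Disj "('f, 'r, 'v) qf" "('f, 'r, 'v) qf"

fun wf_tm :: "('f, 'r) language \<Rightarrow> ('f, 'v) tm \<Rightarrow> bool" where
  "wf_tm L (Var v) \<longleftrightarrow> True"
| "wf_tm L (App f ts) \<longleftrightarrow> f \<in> Funs L \<and> length ts = farity L f \<and> (\<forall>t\<in>set ts. wf_tm L t)"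

fun wf_atom :: "('f, 'r) language \<Rightarrow> ('f, 'r, 'v) atom \<Rightarrow> bool" where
  "wf_atom L (Eq s t) \<longleftrightarrow> wf_tm L s \<and> wf_tm L t"
| "wf_atom L (Rel r ts) \<longleftrightarrow> r \<in> Rels L \<and> length ts = rarity L r \<and> (\<forall>t\<in>set ts. wf_tm L t)"

fun wf_qf :: "('f, 'r) language \<Rightarrow> ('f, 'r, 'v) qf \<Rightarrow> bool" where
  "wf_qf L (Atom \<alpha>) \<longleftrightarrow> wf_atom L \<alpha>"
| "wf_qf L (Neg \<phi>) \<longleftrightarrow> wf_qf L \<phi>"
| "wf_qf L (Conj \<phi> \<psi>) \<longleftrightarrow> wf_qf L \<phi> \<and> wf_qf L \<psi>"
| "wf_qf L (Disj \<phi> \<psi>) \<longleftrightarrow> wf_qf L \<phi> \<and> wf_qf L \<psi>"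

fun tm_val :: "('a, 'f, 'r) struct \<Rightarrow> ('v \<Rightarrow> 'a) \<Rightarrow> ('f, 'v) tm \<Rightarrow> 'a" where
  "tm_val M s (Var v) = s v"
| "tm_val M s (App f ts) = funI M f (map (tm_val M s) ts)"

fun atom_sat :: "('a, 'f, 'r) struct \<Rightarrow> ('v \<Rightarrow> 'a) \<Rightarrow> ('f, 'r, 'v) atom \<Rightarrow> bool" where
  "atom_sat M s (Eq t u) \<longleftrightarrow> tm_val M s t = tm_val M s u"
| "atom_sat M s (Rel r ts) \<longleftrightarrow> relI M r (map (tm_val M s) ts)"

fun qf_sat :: "('a, 'f, 'r) struct \<Rightarrow> ('v \<Rightarrow> 'a) \<Rightarrow> ('f, 'r, 'v) qf \<Rightarrow> bool" where
  "qf_sat M s (Atom \<alpha>) \<longleftrightarrow> atom_sat M s \<alpha>"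
| "qf_sat M s (Neg \<phi>) \<longleftrightarrow> \<not> qf_sat M s \<phi>"
| "qf_sat M s (Conj \<phi> \<psi>) \<longleftrightarrow> qf_sat M s \<phi> \<and> qf_sat M s \<psi>"
| "qf_sat M s (Disj \<phi> \<psi>) \<longleftrightarrow> qf_sat M s \<phi> \<or> qf_sat M s \<psi>"

datatype xy = var_x | var_y

type_synonym ('f, 'r) qf2 = "('f, 'r, xy) qf"

fun assign :: "'a \<Rightarrow> 'a \<Rightarrow> xy \<Rightarrow> 'a" where
  "assign a b var_x = a"
| "assign a b var_y = b"

definition realisations :: "('a, 'f, 'r) struct \<Rightarrow> ('f, 'r) qf2 set \<Rightarrow> ('a \<times> 'a) set" where
  "realisations M p = {(a, b) \<in> univ M \<times> univ M. \<forall>\<phi>\<in>p. qf_sat M (assign a b) \<phi>}"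

text \<open>Complete quantifier-free types over the empty set: finitely satisfiable in \<open>M\<close> and deciding
  every quantifier-free formula; they need not be realised in \<open>M\<close>.\<close>

definition complete_qf_type ::
    "('f, 'r) language \<Rightarrow> ('a, 'f, 'r) struct \<Rightarrow> ('f, 'r) qf2 set \<Rightarrow> bool" where
  "complete_qf_type L M p \<longleftrightarrow>
     p \<subseteq> Collect (wf_qf L) \<and>
     (\<forall>F\<subseteq>p. finite F \<longrightarrow> realisations M F \<noteq> {}) \<and>
     (\<forall>\<phi>. wf_qf L \<phi> \<longrightarrow> \<phi> \<in> p \<or> Neg \<phi> \<in> p)"

definition union_of_qf_types ::
    "('f, 'r) language \<Rightarrow> ('a, 'f, 'r) struct \<Rightarrow> ('a \<times> 'a) set \<Rightarrow> bool" where
  "union_of_qf_types L M R \<longleftrightarrow>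
     (\<exists>P. (\<forall>p\<in>P. complete_qf_type L M p) \<and> R = (\<Union>p\<in>P. realisations M p))"


section \<open>Infinitary disjunctive normal forms\<close>

definition literal :: "('f, 'r) language \<Rightarrow> ('f, 'r) qf2 \<Rightarrow> bool" where
  "literal L \<phi> \<longleftrightarrow> (\<exists>\<alpha>. wf_atom L \<alpha> \<and> (\<phi> = Atom \<alpha> \<or> \<phi> = Neg (Atom \<alpha>)))"

text \<open>A set of sets of literals encodes the disjunction, over its members, of their conjunctions.
  Both levels may be infinite or empty, and any indexed family of literals arises in this way up to
  repetitions.\<close>

type_synonym ('f, 'r) inf_dnf = "('f, 'r) qf2 set set"

definition is_dnf :: "('f, 'r) language \<Rightarrow> ('f, 'r) inf_dnf \<Rightarrow> bool" where
  "is_dnf L \<Phi> \<longleftrightarrow> (\<forall>D\<in>\<Phi>. \<forall>\<phi>\<in>D. literal L \<phi>)"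

definition defined_rel :: "('a, 'f, 'r) struct \<Rightarrow> ('f, 'r) inf_dnf \<Rightarrow> ('a \<times> 'a) set" where
  "defined_rel M \<Phi> =
     {(a, b) \<in> univ M \<times> univ M. \<exists>D\<in>\<Phi>. \<forall>\<phi>\<in>D. qf_sat M (assign a b) \<phi>}"

end

theory Submission
  imports Defs "HOL-Analysis.Function_Topology"
begin

text \<open>Every finite \<open>B\<close> in the class carries a linear order on which the order of a pair depends only
  on its quantifier-free type: applying the Ramsey property successively to the substructures
  generated by the pairs of \<open>B\<close> yields \<open>D\<close> in the class such that, whatever linear order is put on
  \<open>D\<close>, some embedding \<open>B \<rightarrow> D\<close> is monochromatic for all the colourings
  "\<open>f(a) \<le> f(b)\<close>"; the order is then pulled back along it. A compactness argument patches such orders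
  on the finite subsets of \<open>N\<close> together, and the resulting order is the disjunction of the
  conjunctions of literals satisfied by its pairs.\<close>

section \<open>Embeddings\<close>

lemma embeddingI:
  assumes "\<And>x. x \<in> univ A \<Longrightarrow> e x \<in> univ B" "\<And>x. x \<notin> univ A \<Longrightarrow> e x = undefined"
    and "inj_on e (univ A)"
    and "\<And>f xs. f \<in> Funs L \<Longrightarrow> xs \<in> tuples (univ A) (farity L f) \<Longrightarrow>
           e (funI A f xs) = funI B f (map e xs)"
    and "\<And>r xs. r \<in> Rels L \<Longrightarrow> xs \<in> tuples (univ A) (rarity L r) \<Longrightarrow>
           relI A r xs = relI B r (map e xs)"
  shows "e \<in> embeddings L A B"
  using assms by (auto simp: embeddings_def PiE_def extensional_def)

lemma
  assumes "e \<in> embeddings L A B"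
  shows embedding_in: "x \<in> univ A \<Longrightarrow> e x \<in> univ B"
    and embedding_inj: "inj_on e (univ A)"
    and embedding_fun: "f \<in> Funs L \<Longrightarrow> xs \<in> tuples (univ A) (farity L f) \<Longrightarrow>
           e (funI A f xs) = funI B f (map e xs)"
    and embedding_rel: "r \<in> Rels L \<Longrightarrow> xs \<in> tuples (univ A) (rarity L r) \<Longrightarrow>
           relI A r xs = relI B r (map e xs)"
  using assms by (auto simp: embeddings_def PiE_def extensional_def)

lemma tuples_map: "xs \<in> tuples U n \<Longrightarrow> (\<And>x. x \<in> U \<Longrightarrow> e x \<in> V) \<Longrightarrow> map e xs \<in> tuples V n"
  by (auto simp: tuples_def)

lemma is_structure_funI:
  "is_structure L A \<Longrightarrow> f \<in> Funs L \<Longrightarrow> xs \<in> tuples (univ A) (farity L f) \<Longrightarrow> funI A f xs \<in> univ A"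
  by (auto simp: is_structure_def subuniverse_def)

lemma map_cong_tuples:
  "xs \<in> tuples U n \<Longrightarrow> (\<And>x. x \<in> U \<Longrightarrow> f x = g x) \<Longrightarrow> map f xs = map g xs"
  by (auto simp: tuples_def)

lemma compose_embedding:
  assumes "is_structure L A" and f: "f \<in> embeddings L A B" and e: "e \<in> embeddings L B D"
  shows "compose (univ A) e f \<in> embeddings L A D"
proof (rule embeddingI)
  show "inj_on (compose (univ A) e f) (univ A)"
    using embedding_inj[OF f] embedding_inj[OF e] embedding_in[OF f]
    by (auto simp: inj_on_def compose_def)
next
  fix F xs assume F: "F \<in> Funs L" and xs: "xs \<in> tuples (univ A) (farity L F)"
  have eq: "map (compose (univ A) e f) xs = map e (map f xs)"
    using map_cong_tuples[OF xs, of "compose (univ A) e f" "e \<circ> f"] by (simp add: compose_def)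
  have "map f xs \<in> tuples (univ B) (farity L F)"
    using xs embedding_in[OF f] by (rule tuples_map)
  moreover have "compose (univ A) e f (funI A F xs) = e (f (funI A F xs))"
    using is_structure_funI[OF assms(1) F xs] by (simp add: compose_def)
  ultimately show "compose (univ A) e f (funI A F xs) = funI D F (map (compose (univ A) e f) xs)"
    unfolding eq using F xs by (simp only: embedding_fun[OF f] embedding_fun[OF e])
next
  fix r xs assume r: "r \<in> Rels L" and xs: "xs \<in> tuples (univ A) (rarity L r)"
  have eq: "map (compose (univ A) e f) xs = map e (map f xs)"
    using map_cong_tuples[OF xs, of "compose (univ A) e f" "e \<circ> f"] by (simp add: compose_def)
  have "map f xs \<in> tuples (univ B) (rarity L r)"
    using xs embedding_in[OF f] by (rule tuples_map)
  then show "relI A r xs = relI D r (map (compose (univ A) e f) xs)"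
    unfolding eq using r xs by (simp only: embedding_rel[OF f] embedding_rel[OF e])
qed (use embedding_in[OF f] embedding_in[OF e] in \<open>auto simp: compose_def\<close>)

lemma inclusion_embedding:
  assumes "substructure L A B"
  shows "(\<lambda>x\<in>univ A. x) \<in> embeddings L A B"
proof (rule embeddingI)
  have sub: "is_structure L A" "univ A \<subseteq> univ B"
    using assms by (auto simp: substructure_def)
  fix F xs assume F: "F \<in> Funs L" and xs: "xs \<in> tuples (univ A) (farity L F)"
  have "map (\<lambda>x\<in>univ A. x) xs = xs"
    using map_cong_tuples[OF xs, of "\<lambda>x\<in>univ A. x" id] by simp
  then show "(\<lambda>x\<in>univ A. x) (funI A F xs) = funI B F (map (\<lambda>x\<in>univ A. x) xs)"
    using F xs assms is_structure_funI[OF sub(1) F xs] by (simp add: substructure_def)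
next
  fix r xs assume r: "r \<in> Rels L" and xs: "xs \<in> tuples (univ A) (rarity L r)"
  have "map (\<lambda>x\<in>univ A. x) xs = xs"
    using map_cong_tuples[OF xs, of "\<lambda>x\<in>univ A. x" id] by simp
  then show "relI A r xs = relI B r (map (\<lambda>x\<in>univ A. x) xs)"
    using r xs assms by (simp add: substructure_def)
qed (use assms in \<open>auto simp: substructure_def\<close>)

lemma inverse_embedding:
  assumes "is_structure L A" and g: "g \<in> isomorphisms L A B"
  shows "(\<lambda>y\<in>univ B. inv_into (univ A) g y) \<in> embeddings L B A"
proof -
  let ?h = "\<lambda>y\<in>univ B. inv_into (univ A) g y"
  have e: "g \<in> embeddings L A B" and im: "g ` univ A = univ B"
    using g by (auto simp: isomorphisms_def)
  have h: "?h y \<in> univ A" "g (?h y) = y" if "y \<in> univ B" for y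
    using that im by (auto simp: inv_into_into f_inv_into_f)
  have hg: "?h (g x) = x" if "x \<in> univ A" for x
    using that embedding_in[OF e] embedding_inj[OF e] by simp
  have gh: "map g (map ?h xs) = xs" if "xs \<in> tuples (univ B) n" for xs n
    using map_cong_tuples[OF that, of "g \<circ> ?h" id] h by simp
  show ?thesis
  proof (rule embeddingI)
    show "inj_on ?h (univ B)"
      by (rule inj_on_inverseI[where g = g]) (rule h(2))
  next
    fix F xs assume F: "F \<in> Funs L" and xs: "xs \<in> tuples (univ B) (farity L F)"
    have t: "map ?h xs \<in> tuples (univ A) (farity L F)"
      using xs h(1) by (rule tuples_map)
    have "g (funI A F (map ?h xs)) = funI B F xs"
      using embedding_fun[OF e F t] gh[OF xs] by simp
    then show "?h (funI B F xs) = funI A F (map ?h xs)"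
      using hg[OF is_structure_funI[OF assms(1) F t]] by simp
  next
    fix r xs assume r: "r \<in> Rels L" and xs: "xs \<in> tuples (univ B) (rarity L r)"
    have "map ?h xs \<in> tuples (univ A) (rarity L r)"
      using xs h(1) by (rule tuples_map)
    then show "relI B r xs = relI A r (map ?h xs)"
      using embedding_rel[OF e r] gh[OF xs] by simp
  qed (use h in auto)
qed

text \<open>\<open>ERP\<close> speaks of substructures only, so an arbitrary embedding has to be
  replaced by an isomorphism onto its image. The image is closed under the functions because tuples
  in it lift to tuples of \<open>A\<close>.\<close>

lemma image_substructure:
  assumes "is_structure L A" "is_structure L B" and i: "i \<in> embeddings L A B"
  shows "substructure L (B\<lparr>univ := i ` univ A\<rparr>) B" "i \<in> isomorphisms L A (B\<lparr>univ := i ` univ A\<rparr>)"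
proof -
  have "funI B F xs \<in> i ` univ A"
    if F: "F \<in> Funs L" and xs: "xs \<in> tuples (i ` univ A) (farity L F)" for F xs
  proof -
    obtain ys where "xs = map i ys" "ys \<in> tuples (univ A) (farity L F)"
      using xs by (auto simp: tuples_def lists_image in_lists_conv_set)
    then show ?thesis
      using embedding_fun[OF i F] is_structure_funI[OF assms(1) F] by (metis image_eqI)
  qed
  then show "substructure L (B\<lparr>univ := i ` univ A\<rparr>) B"
    using assms(2) embedding_in[OF i]
    by (auto simp: substructure_def is_structure_def subuniverse_def)
  show "i \<in> isomorphisms L A (B\<lparr>univ := i ` univ A\<rparr>)"
    using i by (auto simp: isomorphisms_def embeddings_def)
qed

section \<open>Substructures generated by an assignment\<close>

text \<open>This is the substructure generated by \<open>range s\<close>. Using term values instead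
  of the hull gives every element a name, along which maps out of it can be defined.\<close>

definition term_substructure ::
    "('f, 'r) language \<Rightarrow> ('a, 'f, 'r) struct \<Rightarrow> ('v \<Rightarrow> 'a) \<Rightarrow> ('a, 'f, 'r) struct" where
  "term_substructure L M s = M\<lparr>univ := tm_val M s ` Collect (wf_tm L)\<rparr>"

lemma term_substructure_sel [simp]:
  "univ (term_substructure L M s) = tm_val M s ` Collect (wf_tm L)"
  "funI (term_substructure L M s) = funI M"
  "relI (term_substructure L M s) = relI M"
  by (simp_all add: term_substructure_def)

lemma tm_val_in_subuniverse:
  assumes "subuniverse L M U" "range s \<subseteq> U"
  shows "wf_tm L t \<Longrightarrow> tm_val M s t \<in> U"
proof (induction t)
  case (App f ts)
  then have "map (tm_val M s) ts \<in> tuples U (farity L f)"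
    by (auto simp: tuples_def)
  then show ?case
    using App.prems assms(1) by (simp add: subuniverse_def)
qed (use assms in auto)

lemma tuples_tm_valE:
  assumes "xs \<in> tuples (tm_val M s ` Collect (wf_tm L)) n"
  obtains ts where "xs = map (tm_val M s) ts" "length ts = n" "\<forall>t\<in>set ts. wf_tm L t"
proof -
  have "xs \<in> map (tm_val M s) ` lists (Collect (wf_tm L))"
    using assms by (auto simp: tuples_def lists_image)
  then show ?thesis
    using assms that by (auto simp: tuples_def in_lists_conv_set)
qed

lemma funI_tm_val:
  assumes "f \<in> Funs L" "length ts = farity L f" "\<forall>t\<in>set ts. wf_tm L t"
  shows "funI M f (map (tm_val M s) ts) \<in> tm_val M s ` Collect (wf_tm L)"
  using assms by (intro image_eqI[where x = "App f ts"]) auto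

lemma range_subset_term_substructure: "range s \<subseteq> univ (term_substructure L M s)"
proof -
  have "s v \<in> tm_val M s ` Collect (wf_tm L)" for v
    by (rule image_eqI[where x = "Var v"]) auto
  then show ?thesis by auto
qed

lemma substructure_term_substructure:
  assumes "is_structure L M" "range s \<subseteq> univ M"
  shows "substructure L (term_substructure L M s) M"
proof -
  let ?A = "term_substructure L M s"
  have "univ ?A \<subseteq> univ M"
    using tm_val_in_subuniverse[OF assms(1)[unfolded is_structure_def] assms(2)] by auto
  moreover have "funI M f xs \<in> univ ?A" if f: "f \<in> Funs L" and xs: "xs \<in> tuples (univ ?A) (farity L f)" for f xs
  proof -
    obtain ts where "xs = map (tm_val M s) ts" "length ts = farity L f" "\<forall>t\<in>set ts. wf_tm L t"
      using xs unfolding term_substructure_sel by (rule tuples_tm_valE)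
    then show ?thesis
      using f funI_tm_val by simp
  qed
  ultimately show ?thesis
    using assms(1) unfolding substructure_def is_structure_def[of L ?A] subuniverse_def
    by (simp del: term_substructure_sel(1))
qed

lemma subuniverse_term_substructureD:
  assumes "subuniverse L (term_substructure L M s) U" "range s \<subseteq> U"
  shows "tm_val M s ` Collect (wf_tm L) \<subseteq> U"
proof -
  have "tm_val M s t = tm_val (term_substructure L M s) s t" for t
    by (induction t) (auto cong: map_cong)
  then show ?thesis
    using tm_val_in_subuniverse[OF assms] by auto
qed

text \<open>A subuniverse containing \<open>range s\<close> contains all term values, so the hull is
  everything. This makes \<open>has_age\<close> applicable to the substructures generated by finite
  sets.\<close>

lemma finitely_generated_term_substructure:
  assumes "is_structure L M" "range s \<subseteq> univ M" "finite (range s)"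
  shows "finitely_generated L (term_substructure L M s)"
proof -
  let ?A = "term_substructure L M s"
  have "subuniverse L ?A (univ ?A)"
    using substructure_term_substructure[OF assms(1,2)]
    by (simp only: substructure_def is_structure_def)
  then have "subuniverse L ?A hull range s = univ ?A"
    using subuniverse_term_substructureD[of L M s] range_subset_term_substructure[of s L M]
    unfolding hull_def by (intro equalityI Inter_lower Inter_greatest) auto
  then show ?thesis
    using assms(3) range_subset_term_substructure[of s L M] unfolding finitely_generated_def
    by (intro exI[of _ "range s"] conjI)
qed

section \<open>Quantifier-free types\<close>

text \<open>Equality of quantifier-free types, for assignments in possibly different structures on
  different carriers. Atoms suffice because quantifier-free formulas are their Boolean
  combinations.\<close>

definition same_atoms :: "('f, 'r) language \<Rightarrow> ('a, 'f, 'r) struct \<Rightarrow> ('v \<Rightarrow> 'a) \<Rightarrow>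
    ('b, 'f, 'r) struct \<Rightarrow> ('v \<Rightarrow> 'b) \<Rightarrow> bool" where
  "same_atoms L M s M' s' \<longleftrightarrow> (\<forall>\<alpha>. wf_atom L \<alpha> \<longrightarrow> atom_sat M s \<alpha> = atom_sat M' s' \<alpha>)"

lemma same_atoms_sym: "same_atoms L M s M' s' \<Longrightarrow> same_atoms L M' s' M s"
  by (simp add: same_atoms_def)

lemma same_atoms_trans:
  "same_atoms L M s M' s' \<Longrightarrow> same_atoms L M' s' M'' s'' \<Longrightarrow> same_atoms L M s M'' s''"
  by (simp add: same_atoms_def)

lemma same_atoms_qf_sat:
  "same_atoms L M s M' s' \<Longrightarrow> wf_qf L \<phi> \<Longrightarrow> qf_sat M s \<phi> = qf_sat M' s' \<phi>"
  by (induction \<phi>) (auto simp: same_atoms_def)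

lemma tm_val_embedding:
  assumes "is_structure L A" and e: "e \<in> embeddings L A B" and s: "range s \<subseteq> univ A"
    and s': "\<And>v. s' v = e (s v)"
  shows "wf_tm L t \<Longrightarrow> tm_val B s' t = e (tm_val A s t)"
proof (induction t)
  case (App f ts)
  have "map (tm_val A s) ts \<in> tuples (univ A) (farity L f)"
    using App.prems tm_val_in_subuniverse[OF assms(1)[unfolded is_structure_def] s]
    by (auto simp: tuples_def)
  moreover have "map (tm_val B s') ts = map e (map (tm_val A s) ts)"
    using App by simp
  ultimately show ?case
    using App.prems embedding_fun[OF e] by (simp add: comp_def cong: map_cong)
qed (simp add: s')

text \<open>Term evaluation commutes with an embedding; injectivity is what makes equations pass
  from \<open>B\<close> back to \<open>A\<close>.\<close>

lemma same_atoms_embedding: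
  fixes L :: "('f, 'r) language" and s :: "'v \<Rightarrow> 'a"
  assumes "is_structure L A" and e: "e \<in> embeddings L A B" and s: "range s \<subseteq> univ A"
    and s': "\<And>v. s' v = e (s v)"
  shows "same_atoms L A s B s'"
  unfolding same_atoms_def
proof (intro allI impI)
  note val = tm_val_embedding[OF assms]
  note val_in = tm_val_in_subuniverse[OF assms(1)[unfolded is_structure_def] s]
  fix \<alpha> :: "('f, 'r, 'v) atom" assume wf: "wf_atom L \<alpha>"
  show "atom_sat A s \<alpha> = atom_sat B s' \<alpha>"
  proof (cases \<alpha>)
    case (Eq t u)
    then show ?thesis
      using wf val val_in embedding_inj[OF e] by (simp add: inj_on_eq_iff)
  next
    case (Rel r ts)
    have "map (tm_val A s) ts \<in> tuples (univ A) (rarity L r)"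
      using wf Rel val_in by (auto simp: tuples_def)
    moreover have "map (tm_val B s') ts = map e (map (tm_val A s) ts)"
      using wf Rel val by simp
    ultimately show ?thesis
      using wf Rel embedding_rel[OF e] by (simp add: comp_def cong: map_cong)
  qed
qed

text \<open>Send the value of each term at \<open>s\<close> to its value at \<open>s'\<close>.
  Agreement on equations makes this well defined and injective, and agreement on relational atoms
  makes it an embedding.\<close>

lemma same_atoms_imp_embedding:
  assumes "is_structure L M'" "range s' \<subseteq> univ M'"
    and same: "same_atoms L M s M' s'"
  shows "\<exists>f\<in>embeddings L (term_substructure L M s) M'. \<forall>v. f (s v) = s' v"
proof -
  let ?A = "term_substructure L M s"
  have eq: "tm_val M s t = tm_val M s u \<longleftrightarrow> tm_val M' s' t = tm_val M' s' u"
    if "wf_tm L t" "wf_tm L u" for t u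
    using same[unfolded same_atoms_def, rule_format, of "Eq t u"] that by simp
  \<comment> \<open>An arbitrary term naming \<open>x\<close> is chosen; by \<open>eq\<close> the
    resulting value does not depend on the choice.\<close>
  define f where
    "f = (\<lambda>x\<in>univ ?A. tm_val M' s' (SOME t. wf_tm L t \<and> tm_val M s t = x))"
  have f: "f (tm_val M s t) = tm_val M' s' t" if "wf_tm L t" for t
  proof -
    let ?u = "SOME u. wf_tm L u \<and> tm_val M s u = tm_val M s t"
    have "\<exists>u. wf_tm L u \<and> tm_val M s u = tm_val M s t"
      using that by blast
    then have "wf_tm L ?u \<and> tm_val M s ?u = tm_val M s t"
      by (rule someI_ex)
    then show ?thesis
      using that eq[of ?u t] by (simp add: f_def)
  qed
  have fmap: "map f (map (tm_val M s) ts) = map (tm_val M' s') ts" if "\<forall>t\<in>set ts. wf_tm L t" for ts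
    using that f by simp
  have "f \<in> embeddings L ?A M'"
  proof (rule embeddingI)
    show "f x \<in> univ M'" if "x \<in> univ ?A" for x
      using that f tm_val_in_subuniverse[OF assms(1)[unfolded is_structure_def] assms(2)] by auto
    show "inj_on f (univ ?A)"
      using f eq by (auto simp: inj_on_def)
  next
    fix F xs assume F: "F \<in> Funs L" and "xs \<in> tuples (univ ?A) (farity L F)"
    then obtain ts where ts: "xs = map (tm_val M s) ts" "length ts = farity L F"
        "\<forall>t\<in>set ts. wf_tm L t"
      by (auto elim: tuples_tm_valE)
    then show "f (funI ?A F xs) = funI M' F (map f xs)"
      using f[of "App F ts"] F fmap[of ts] by (simp add: comp_def cong: map_cong)
  next
    fix r xs assume r: "r \<in> Rels L" and "xs \<in> tuples (univ ?A) (rarity L r)"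
    then obtain ts where ts: "xs = map (tm_val M s) ts" "length ts = rarity L r"
        "\<forall>t\<in>set ts. wf_tm L t"
      by (auto elim: tuples_tm_valE)
    then show "relI ?A r xs = relI M' r (map f xs)"
      using same[unfolded same_atoms_def, rule_format, of "Rel r ts"] r fmap[of ts]
      by (simp add: comp_def cong: map_cong)
  qed (simp add: f_def)
  moreover have "f (s v) = s' v" for v
    using f[of "Var v"] by simp
  ultimately show ?thesis by blast
qed

section \<open>Types of pairs\<close>

lemma range_assign: "range (assign a b) = {a, b}"
proof
  have "assign a b v \<in> {a, b}" for v
    by (cases v) auto
  then show "range (assign a b) \<subseteq> {a, b}" by blast
  show "{a, b} \<subseteq> range (assign a b)"
    using rangeI[of "assign a b" var_x] rangeI[of "assign a b" var_y] by simp
qed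

lemma same_atoms_assign_embedding:
  assumes "is_structure L A" "e \<in> embeddings L A B" "a \<in> univ A" "b \<in> univ A"
  shows "same_atoms L A (assign a b) B (assign (e a) (e b))"
proof (rule same_atoms_embedding[OF assms(1,2)])
  show "range (assign a b) \<subseteq> univ A"
    using assms(3,4) by (simp add: range_assign)
  show "assign (e a) (e b) v = e (assign a b v)" for v
    by (cases v) simp_all
qed

text \<open>Types are evaluated in \<open>M\<close> while only pairs from \<open>U\<close> are
  compared, so \<open>U\<close> may be a finite set that is not a subuniverse.\<close>

definition qf_invariant_on ::
    "('f, 'r) language \<Rightarrow> ('a, 'f, 'r) struct \<Rightarrow> 'a set \<Rightarrow> ('a \<times> 'a) set \<Rightarrow> bool" where
  "qf_invariant_on L M U R \<longleftrightarrow> (\<forall>a\<in>U. \<forall>b\<in>U. \<forall>c\<in>U. \<forall>d\<in>U.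
     same_atoms L M (assign a b) M (assign c d) \<longrightarrow> ((a, b) \<in> R \<longleftrightarrow> (c, d) \<in> R))"

lemma complete_qf_type_of_pair:
  assumes "a \<in> univ M" "b \<in> univ M"
  shows "complete_qf_type L M {\<phi>. wf_qf L \<phi> \<and> qf_sat M (assign a b) \<phi>}"
  using assms by (auto simp: complete_qf_type_def realisations_def)

lemma realisations_type_of_pair:
  "realisations M {\<phi>. wf_qf L \<phi> \<and> qf_sat M (assign a b) \<phi>} =
     {(c, d) \<in> univ M \<times> univ M. same_atoms L M (assign a b) M (assign c d)}"
proof -
  \<comment> \<open>The type of a pair contains each atom or its negation, so preservation in one
    direction already gives agreement.\<close>
  have "same_atoms L M (assign a b) M (assign c d)"
    if "\<forall>\<phi>. wf_qf L \<phi> \<and> qf_sat M (assign a b) \<phi> \<longrightarrow> qf_sat M (assign c d) \<phi>" for c d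
    unfolding same_atoms_def
    using that[rule_format, of "Atom _"] that[rule_format, of "Neg (Atom _)"] by auto
  then show ?thesis
    by (auto simp: realisations_def same_atoms_qf_sat)
qed

text \<open>Negated atoms turn one-way preservation into agreement. The second structure is
  arbitrary, which later allows one formula to be read both in \<open>N\<close> and in the members
  of the class.\<close>

lemma literals_sat_iff_same_atoms:
  "(\<forall>\<phi>. literal L \<phi> \<and> qf_sat M (assign a b) \<phi> \<longrightarrow> qf_sat M' (assign c d) \<phi>) \<longleftrightarrow>
     same_atoms L M (assign a b) M' (assign c d)"
  by (auto simp: literal_def same_atoms_def)

section \<open>Pulling back linear orders\<close>

definition pullback :: "('a \<Rightarrow> 'b) \<Rightarrow> 'a set \<Rightarrow> ('b \<times> 'b) set \<Rightarrow> ('a \<times> 'a) set" where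
  "pullback e A R = {(x, y) \<in> A \<times> A. (e x, e y) \<in> R}"

lemma linear_order_on_pullback:
  assumes "linear_order_on B R" "inj_on e A" "e ` A \<subseteq> B"
  shows "linear_order_on A (pullback e A R)"
proof -
  have R: "refl_on B R" "trans R" "antisym R" "total_on B R"
    using assms(1) by (auto simp: order_on_defs)
  have "refl_on A (pullback e A R)"
    using R(1) assms(3) by (auto simp: refl_on_def pullback_def)
  moreover have "trans (pullback e A R)"
    using R(2) unfolding trans_def pullback_def by blast
  moreover have "antisym (pullback e A R)"
    using R(3) assms(2) by (auto simp: antisym_def pullback_def inj_on_def)
  moreover have "total_on A (pullback e A R)"
  proof (rule total_onI)
    fix x y assume xy: "x \<in> A" "y \<in> A" "x \<noteq> y"
    then have "e x \<in> B" "e y \<in> B" "e x \<noteq> e y"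
      using assms(2,3) by (auto simp: inj_on_def)
    then show "(x, y) \<in> pullback e A R \<or> (y, x) \<in> pullback e A R"
      using R(4) xy by (simp add: total_on_def pullback_def)
  qed
  ultimately show ?thesis
    by (auto simp: order_on_defs pullback_def)
qed

text \<open>Each axiom of a linear order concerns at most three points.\<close>

lemma linear_order_on_locallyI:
  assumes "R \<subseteq> U \<times> U"
    and local: "\<And>F. finite F \<Longrightarrow> F \<subseteq> U \<Longrightarrow> linear_order_on F (R \<inter> F \<times> F)"
  shows "linear_order_on U R"
proof -
  have loc: "refl_on F (R \<inter> F \<times> F)" "trans (R \<inter> F \<times> F)" "antisym (R \<inter> F \<times> F)"
      "total_on F (R \<inter> F \<times> F)" if "finite F" "F \<subseteq> U" for F
    using local[OF that] by (auto simp: order_on_defs)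
  have "refl_on U R"
  proof (rule refl_onI)
    show "(x, x) \<in> R" if "x \<in> U" for x
      using loc(1)[of "{x}"] that by (auto simp: refl_on_def)
  qed
  moreover have "trans R"
  proof (rule transI)
    fix x y z assume xyz: "(x, y) \<in> R" "(y, z) \<in> R"
    then have "{x, y, z} \<subseteq> U" using assms(1) by auto
    then show "(x, z) \<in> R"
      using transD[OF loc(2)[of "{x, y, z}"], of x y z] xyz by auto
  qed
  moreover have "antisym R"
  proof (rule antisymI)
    fix x y assume xy: "(x, y) \<in> R" "(y, x) \<in> R"
    then have "{x, y} \<subseteq> U" using assms(1) by auto
    then show "x = y"
      using antisymD[OF loc(3)[of "{x, y}"], of x y] xy by auto
  qed
  moreover have "total_on U R"
  proof (rule total_onI)
    fix x y assume "x \<in> U" "y \<in> U" "x \<noteq> y"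
    then show "(x, y) \<in> R \<or> (y, x) \<in> R"
      using loc(4)[of "{x, y}"] by (auto simp: total_on_def)
  qed
  ultimately show ?thesis
    using assms(1) by (simp add: order_on_defs)
qed

section \<open>Ramsey classes\<close>

lemma
  assumes "ramsey_class L C" "B \<in> C"
  shows ramsey_class_structure: "is_structure L B"
    and ramsey_class_finite: "finite (univ B)"
    and ramsey_class_substructure: "substructure L A B \<Longrightarrow> A \<in> C"
    and ramsey_class_arrow: "substructure L A B \<Longrightarrow> \<exists>D\<in>C. ramsey_arrow L D B A"
proof -
  have C: "\<forall>A\<in>C. is_structure L A \<and> finite (univ A)" "HP L C" "ERP L C"
    using assms(1) by (simp_all add: ramsey_class_def)
  show "is_structure L B" "finite (univ B)"
    using C(1) assms(2) by blast+
  show "A \<in> C" if "substructure L A B"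
    using C(2) assms(2) that unfolding HP_def by blast
  then show "\<exists>D\<in>C. ramsey_arrow L D B A" if "substructure L A B"
    using C(3) assms(2) that unfolding ERP_def by blast
qed

lemma substructure_refl: "is_structure L A \<Longrightarrow> substructure L A A"
  by (simp add: substructure_def)

text \<open>This frees the Ramsey property from the assumption that \<open>A\<close> is a
  substructure of \<open>B\<close>: colourings are transported along an isomorphism from
  \<open>A\<close> to a copy of it inside \<open>B\<close>.\<close>

lemma ramsey_class_embedding_arrow:
  assumes C: "ramsey_class L C" and "A \<in> C" "B \<in> C"
  shows "\<exists>D\<in>C. ramsey_arrow L D B A"
proof (cases "embeddings L A B = {}")
  case True
  have "substructure L B B"
    using substructure_refl[OF ramsey_class_structure[OF C assms(3)]] .
  \<comment> \<open>Without copies of \<open>A\<close> in \<open>B\<close>, the constancy condition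
    is vacuous and the identity of \<open>B\<close> serves.\<close>
  then have "ramsey_arrow L B B A"
    using True inclusion_embedding unfolding ramsey_arrow_def by blast
  then show ?thesis using assms(3) by blast
next
  case False
  then obtain i where i: "i \<in> embeddings L A B" by blast
  have st: "is_structure L A" "is_structure L B"
    using ramsey_class_structure[OF C] assms(2,3) by blast+
  let ?A = "B\<lparr>univ := i ` univ A\<rparr>"
  note im = image_substructure[OF st i]
  have stA: "is_structure L ?A"
    using im(1) by (simp add: substructure_def)
  have ie: "i \<in> embeddings L A ?A"
    using im(2) by (simp add: isomorphisms_def)
  obtain D where D: "D \<in> C" "ramsey_arrow L D B ?A"
    using ramsey_class_arrow[OF C assms(3) im(1)] by blast
  let ?j = "\<lambda>y\<in>univ ?A. inv_into (univ A) i y"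
  have j: "?j \<in> embeddings L ?A A"
    using inverse_embedding[OF st(1) im(2)] .
  have "ramsey_arrow L D B A"
    unfolding ramsey_arrow_def
  proof
    fix \<chi> assume \<chi>: "\<chi> \<in> embeddings L A D \<rightarrow> {0, 1::nat}"
    \<comment> \<open>Copies of \<open>?A\<close> are coloured by turning them into copies of
      \<open>A\<close> through \<open>i\<close>.\<close>
    let ?\<chi> = "\<lambda>g. \<chi> (compose (univ A) g i)"
    have "?\<chi> \<in> embeddings L ?A D \<rightarrow> {0, 1::nat}"
      using \<chi> compose_embedding[OF st(1) ie] by blast
    from bspec[OF D(2)[unfolded ramsey_arrow_def] this] obtain e c
      where e: "e \<in> embeddings L B D"
        and c: "\<forall>f\<in>embeddings L ?A B. ?\<chi> (compose (univ ?A) e f) = c"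
      by blast
    have "\<chi> (compose (univ A) e f) = c" if f: "f \<in> embeddings L A B" for f
    proof -
      \<comment> \<open>Precomposing with \<open>i\<close> cancels the inverse contained in
        \<open>?f\<close>, so the colour \<open>c\<close> carries over to \<open>f\<close>.\<close>
      let ?f = "compose (univ ?A) f ?j"
      have "compose (univ A) (compose (univ ?A) e ?f) i = compose (univ A) e f"
        using embedding_inj[OF i] by (intro ext) (simp add: compose_def)
      then show ?thesis
        using bspec[OF c compose_embedding[OF stA j f]] by simp
    qed
    then show "\<exists>e\<in>embeddings L B D. \<exists>c. \<forall>f\<in>embeddings L A B. \<chi> (compose (univ A) e f) = c"
      using e by blast
  qed
  then show ?thesis using D(1) by blast
qed

text \<open>Induction on \<open>Q\<close>, with one Ramsey step per pair. The relation
  \<open>R\<close> is arbitrary and chosen after \<open>D\<close>, so that the induction hypothesis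
  can be applied to a pullback of \<open>R\<close>.\<close>

lemma ramsey_class_simultaneous:
  assumes C: "ramsey_class L C" and B: "B \<in> C"
    and "finite Q" "Q \<subseteq> univ B \<times> univ B"
  shows "\<exists>D\<in>C. \<forall>R. \<exists>e\<in>embeddings L B D. \<forall>(a, b)\<in>Q.
    \<forall>f\<in>embeddings L (term_substructure L B (assign a b)) B.
      (e (f a), e (f b)) \<in> R \<longleftrightarrow> (e a, e b) \<in> R"
  using assms(3,4)
proof (induction Q rule: finite_induct)
  case empty
  have "substructure L B B"
    using substructure_refl[OF ramsey_class_structure[OF C B]] .
  then show ?case
    using B inclusion_embedding by fast
next
  case (insert p Q)
  obtain a b where p: "p = (a, b)" by fastforce
  have ab: "a \<in> univ B" "b \<in> univ B"
    using insert.prems p by auto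
  let ?s = "assign a b"
  let ?A = "term_substructure L B ?s"
  note stB = ramsey_class_structure[OF C B]
  have sub: "substructure L ?A B"
    using stB ab by (intro substructure_term_substructure) (auto simp: range_assign)
  have AC: "?A \<in> C"
    using ramsey_class_substructure[OF C B sub] .
  have stA: "is_structure L ?A"
    using ramsey_class_structure[OF C AC] .
  have abA: "a \<in> univ ?A" "b \<in> univ ?A"
    using range_subset_term_substructure[of ?s L B] by (auto simp: range_assign)
  obtain D where D: "D \<in> C" and DQ: "\<And>R. \<exists>e\<in>embeddings L B D. \<forall>(a, b)\<in>Q.
      \<forall>f\<in>embeddings L (term_substructure L B (assign a b)) B.
        (e (f a), e (f b)) \<in> R \<longleftrightarrow> (e a, e b) \<in> R"
    using insert by auto
  \<comment> \<open>The Ramsey target is the whole of \<open>D\<close>, so a monochromatic copy of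
    \<open>D\<close> retains what \<open>D\<close> achieves for \<open>Q\<close>.\<close>
  obtain D' where D': "D' \<in> C" "ramsey_arrow L D' D ?A"
    using ramsey_class_embedding_arrow[OF C AC D] by blast
  have "\<exists>e\<in>embeddings L B D'. \<forall>(a, b)\<in>insert p Q.
      \<forall>f\<in>embeddings L (term_substructure L B (assign a b)) B.
        (e (f a), e (f b)) \<in> R \<longleftrightarrow> (e a, e b) \<in> R" for R
  proof -
    \<comment> \<open>A copy of \<open>?A\<close> is coloured by whether \<open>R\<close> holds
      between the images of its two generators.\<close>
    define \<chi> where "\<chi> = (\<lambda>g. if (g a, g b) \<in> R then 1 else 0::nat)"
    have "\<chi> \<in> embeddings L ?A D' \<rightarrow> {0, 1}"
      by (auto simp: \<chi>_def)
    then obtain h c where h: "h \<in> embeddings L D D'"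
      and c: "\<And>f. f \<in> embeddings L ?A D \<Longrightarrow> \<chi> (compose (univ ?A) h f) = c"
      using D'(2) unfolding ramsey_arrow_def by metis
    have mono: "(h (f a), h (f b)) \<in> R \<longleftrightarrow> (h (g a), h (g b)) \<in> R"
      if "f \<in> embeddings L ?A D" "g \<in> embeddings L ?A D" for f g
      using c[OF that(1)] c[OF that(2)] abA
      by (simp add: \<chi>_def compose_def split: if_splits)
    \<comment> \<open>First \<open>h\<close> makes the colour of the new pair constant on copies of
      \<open>?A\<close> in \<open>D\<close>; then \<open>e\<close> handles the old pairs inside
      \<open>D\<close>, with \<open>R\<close> seen through \<open>h\<close>.\<close>
    obtain e where e: "e \<in> embeddings L B D" and eQ: "\<forall>(a, b)\<in>Q.
        \<forall>f\<in>embeddings L (term_substructure L B (assign a b)) B.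
          (e (f a), e (f b)) \<in> pullback h (univ D) R \<longleftrightarrow> (e a, e b) \<in> pullback h (univ D) R"
      using DQ[of "pullback h (univ D) R"] by blast
    let ?e = "compose (univ B) h e"
    have e': "?e x = h (e x)" "e x \<in> univ D" if "x \<in> univ B" for x
      using that embedding_in[OF e] by (auto simp: compose_def)
    have in_term: "x \<in> univ (term_substructure L B (assign x y))"
        "y \<in> univ (term_substructure L B (assign x y))" for x y
      using range_subset_term_substructure[of "assign x y" L B] by (auto simp: range_assign)
    have "(?e (f x), ?e (f y)) \<in> R \<longleftrightarrow> (?e x, ?e y) \<in> R"
      if xy: "(x, y) \<in> insert p Q" and f: "f \<in> embeddings L (term_substructure L B (assign x y)) B"
      for x y f
    proof -
      have B': "x \<in> univ B" "y \<in> univ B" "f x \<in> univ B" "f y \<in> univ B"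
        using xy insert.prems embedding_in[OF f in_term(1)] embedding_in[OF f in_term(2)] by auto
      show ?thesis
      proof (cases "(x, y) \<in> Q")
        case True
        then show ?thesis
          using eQ f B' e' by (fastforce simp: pullback_def)
      next
        case False
        then have xy: "x = a" "y = b" using xy p by auto
        have "compose (univ ?A) e f \<in> embeddings L ?A D"
          using compose_embedding[OF stA _ e] f xy by simp
        \<comment> \<open>The inclusion of \<open>?A\<close> in \<open>B\<close> represents the pair
          \<open>(a, b)\<close> itself, with which the copy given by \<open>f\<close> is
          compared.\<close>
        moreover have "compose (univ ?A) e (\<lambda>x\<in>univ ?A. x) \<in> embeddings L ?A D"
          using compose_embedding[OF stA inclusion_embedding[OF sub] e] .
        ultimately show ?thesis
          using mono[of "compose (univ ?A) e f" "compose (univ ?A) e (\<lambda>x\<in>univ ?A. x)"] abA e' B' xy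
          by (simp add: compose_def)
      qed
    qed
    then show ?thesis
      using compose_embedding[OF stB e h] by (intro bexI[of _ ?e]) auto
  qed
  then show ?case using D'(1) by blast
qed

text \<open>Finiteness of \<open>B\<close> allows all its pairs to be treated at once, and an order
  on \<open>D\<close> is then pulled back.\<close>

lemma ramsey_class_invariant_order:
  assumes C: "ramsey_class L C" and B: "B \<in> C"
  shows "\<exists>R. linear_order_on (univ B) R \<and> qf_invariant_on L B (univ B) R"
proof -
  note stB = ramsey_class_structure[OF C B] and fin = ramsey_class_finite[OF C B]
  obtain D where "D \<in> C" and D: "\<forall>R. \<exists>e\<in>embeddings L B D. \<forall>(a, b)\<in>univ B \<times> univ B.
      \<forall>f\<in>embeddings L (term_substructure L B (assign a b)) B.
        (e (f a), e (f b)) \<in> R \<longleftrightarrow> (e a, e b) \<in> R"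
    using ramsey_class_simultaneous[OF C B finite_cartesian_product[OF fin fin] subset_refl]
    by (rule bexE) (rule that)
  \<comment> \<open>Carriers in the class are sets of naturals, so the usual order is available on
    \<open>D\<close>.\<close>
  from D[rule_format, of "{(x, y). x \<le> y}"]
  obtain e where e: "e \<in> embeddings L B D" and inv: "\<And>a b f. a \<in> univ B \<Longrightarrow> b \<in> univ B \<Longrightarrow>
      f \<in> embeddings L (term_substructure L B (assign a b)) B \<Longrightarrow> e (f a) \<le> e (f b) \<longleftrightarrow> e a \<le> e b"
    by (auto simp del: term_substructure_sel)
  let ?R = "pullback e (univ B) {(x, y). x \<le> y}"
  have "linear_order_on UNIV {(x, y :: nat). x \<le> y}"
    by (auto simp: order_on_defs refl_on_def trans_def antisym_def total_on_def)
  then have "linear_order_on (univ B) ?R"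
    using embedding_inj[OF e] by (rule linear_order_on_pullback) simp
  moreover have "(a, b) \<in> ?R \<longleftrightarrow> (c, d) \<in> ?R"
    if U: "a \<in> univ B" "b \<in> univ B" "c \<in> univ B" "d \<in> univ B"
      and same: "same_atoms L B (assign a b) B (assign c d)" for a b c d
  proof -
    have "range (assign c d) \<subseteq> univ B"
      using U by (simp add: range_assign)
    \<comment> \<open>Pairs of equal type are related by an embedding of the substructure generated
      by the first pair, and \<open>inv\<close> applies to exactly such embeddings.\<close>
    then obtain f where f: "f \<in> embeddings L (term_substructure L B (assign a b)) B"
      and fs: "\<And>v. f (assign a b v) = assign c d v"
      using same_atoms_imp_embedding[OF stB _ same] by blast
    show ?thesis
      using inv[OF U(1,2) f] fs[of var_x] fs[of var_y] U by (simp add: pullback_def)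
  qed
  ultimately show ?thesis
    unfolding qf_invariant_on_def by blast
qed

section \<open>Compactness\<close>

text \<open>Tychonoff for the space of maps from \<open>'b\<close> to \<open>bool\<close>:
  \<open>S\<close> is a cluster point of the net sending a finite \<open>F\<close> to
  \<open>R F\<close>, so every basic neighbourhood of \<open>S\<close> is visited by arbitrarily
  large \<open>F\<close>.\<close>

lemma finite_selection_bool:
  fixes R :: "'a set \<Rightarrow> 'b \<Rightarrow> bool"
  shows "\<exists>S. \<forall>Q F\<^sub>0. finite Q \<and> finite F\<^sub>0 \<and> F\<^sub>0 \<subseteq> U \<longrightarrow>
    (\<exists>F. finite F \<and> F\<^sub>0 \<subseteq> F \<and> F \<subseteq> U \<and> (\<forall>q\<in>Q. S q = R F q))"
proof -
  have "compact_space (product_topology (\<lambda>i::'b. euclidean :: bool topology) UNIV)"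
    unfolding compact_space_product_topology
    by (simp add: compact_space_def finite_imp_compact)
  then have "compact (UNIV :: ('b \<Rightarrow> bool) set)"
    by (simp add: compact_space_def euclidean_product_topology)
  moreover define G where "G = filtermap R (finite_subsets_at_top U)"
  have "G \<noteq> bot"
    by (simp add: G_def filtermap_bot_iff)
  ultimately obtain S where S: "inf (nhds S) G \<noteq> bot"
    unfolding compact_filter by auto
  have "\<exists>F. finite F \<and> F\<^sub>0 \<subseteq> F \<and> F \<subseteq> U \<and> (\<forall>q\<in>Q. S q = R F q)"
    if Q: "finite Q" and F0: "finite F\<^sub>0" "F\<^sub>0 \<subseteq> U" for Q F\<^sub>0
  proof (rule ccontr)
    assume none: "\<not> ?thesis"
    \<comment> \<open>Agreement with \<open>S\<close> on the finite set \<open>Q\<close> is a basic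
      open condition. If it failed for all finite sets above \<open>F\<^sub>0\<close>, the net would
      eventually leave this neighbourhood.\<close>
    have "open {f. \<forall>q\<in>Q. f q \<in> {S q}}"
      by (rule product_topology_basis'[OF Q]) (rule open_discrete)
    then have "eventually (\<lambda>f. \<forall>q\<in>Q. f q = S q) (nhds S)"
      by (auto simp: eventually_nhds)
    moreover have "eventually (\<lambda>f. \<not> (\<forall>q\<in>Q. f q = S q)) G"
      unfolding G_def eventually_filtermap eventually_finite_subsets_at_top
      using F0 none by metis
    ultimately have "eventually (\<lambda>f. False) (inf (nhds S) G)"
      unfolding eventually_inf by blast
    then show False
      using S by (simp add: trivial_limit_def)
  qed
  then show ?thesis by blast
qed

section \<open>Invariant orders on \<open>N\<close>\<close>

text \<open>The substructure generated by \<open>F\<close> is isomorphic to a member of the class,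
  whose invariant order is pulled back to \<open>F\<close>.\<close>

lemma finite_subset_invariant_order:
  assumes C: "ramsey_class L C" and N: "is_structure L N" and age: "has_age L N C"
    and F: "finite F" "F \<subseteq> univ N"
  shows "\<exists>R. linear_order_on F R \<and> qf_invariant_on L N F R"
proof (cases "F = {}")
  case True
  then have "linear_order_on F {} \<and> qf_invariant_on L N F {}"
    by (simp add: qf_invariant_on_def)
  then show ?thesis ..
next
  case False
  then obtain x where x: "x \<in> F" by blast
  \<comment> \<open>The elements of the carrier serve as variables; the default \<open>x\<close>
    makes the range exactly \<open>F\<close>. This is why the empty set is treated apart.\<close>
  define s where "s = (\<lambda>v. if v \<in> F then v else x)"
  have s: "range s = F" using x by (auto simp: s_def)
  let ?A = "term_substructure L N s"
  have sub: "substructure L ?A N" and "finitely_generated L ?A"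
    using N F s substructure_term_substructure finitely_generated_term_substructure by blast+
  then obtain B where B: "B \<in> C" "isomorphic L ?A B"
    using age by (auto simp: has_age_def)
  then obtain g where g: "g \<in> embeddings L ?A B"
    by (auto simp: isomorphic_def isomorphisms_def)
  have stA: "is_structure L ?A" using sub by (simp add: substructure_def)
  have FA: "F \<subseteq> univ ?A" using range_subset_term_substructure[of s L N] s by simp
  obtain R where R: "linear_order_on (univ B) R" "qf_invariant_on L B (univ B) R"
    using ramsey_class_invariant_order[OF C B(1)] by blast
  have gB: "g a \<in> univ B" if "a \<in> F" for a
    using that FA embedding_in[OF g] by blast
  have "linear_order_on F (pullback g F R)"
    using R(1) embedding_inj[OF g] FA gB
    by (intro linear_order_on_pullback) (auto intro: inj_on_subset)
  moreover have "qf_invariant_on L N F (pullback g F R)"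
    unfolding qf_invariant_on_def
  proof (intro ballI impI)
    fix a b c d assume F': "a \<in> F" "b \<in> F" "c \<in> F" "d \<in> F"
      and same: "same_atoms L N (assign a b) N (assign c d)"
    \<comment> \<open>Types in \<open>N\<close> and in \<open>B\<close> are compared through
      \<open>?A\<close>, which embeds in both.\<close>
    have to_B: "same_atoms L N (assign u v) B (assign (g u) (g v))" if "u \<in> F" "v \<in> F" for u v
    proof -
      have uv: "u \<in> univ ?A" "v \<in> univ ?A" using that FA by auto
      show ?thesis
        using same_atoms_assign_embedding[OF stA inclusion_embedding[OF sub] uv]
          same_atoms_assign_embedding[OF stA g uv] uv
        by (auto simp del: term_substructure_sel dest: same_atoms_sym intro: same_atoms_trans)
    qed
    have "same_atoms L B (assign (g a) (g b)) B (assign (g c) (g d))"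
      using F' same to_B same_atoms_sym same_atoms_trans by meson
    then show "(a, b) \<in> pullback g F R \<longleftrightarrow> (c, d) \<in> pullback g F R"
      using R(2) F' gB by (simp add: qf_invariant_on_def pullback_def)
  qed
  ultimately show ?thesis by blast
qed

text \<open>The orders chosen on finite sets need not cohere, but linearity and invariance each
  concern finitely many points and so survive in a cluster point.\<close>

lemma age_invariant_order:
  assumes C: "ramsey_class L C" and N: "is_structure L N" and age: "has_age L N C"
  shows "\<exists>R. linear_order_on (univ N) R \<and> qf_invariant_on L N (univ N) R"
proof -
  obtain T where T: "\<And>F. finite F \<Longrightarrow> F \<subseteq> univ N \<Longrightarrow>
      linear_order_on F (T F) \<and> qf_invariant_on L N F (T F)"
    using finite_subset_invariant_order[OF assms] by metis
  obtain S where S: "\<And>Q F\<^sub>0. finite Q \<Longrightarrow> finite F\<^sub>0 \<Longrightarrow> F\<^sub>0 \<subseteq> univ N \<Longrightarrow>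
      \<exists>F. finite F \<and> F\<^sub>0 \<subseteq> F \<and> F \<subseteq> univ N \<and> (\<forall>q\<in>Q. S q = (q \<in> T F))"
    using finite_selection_bool[of "univ N" "\<lambda>F q. q \<in> T F"] by metis
  define R where "R = {q \<in> univ N \<times> univ N. S q}"
  \<comment> \<open>On each finite set the limit coincides with one of the chosen orders, taken on
    some larger finite set.\<close>
  have approx: "\<exists>F. finite F \<and> F\<^sub>0 \<subseteq> F \<and> F \<subseteq> univ N \<and> R \<inter> F\<^sub>0 \<times> F\<^sub>0 = T F \<inter> F\<^sub>0 \<times> F\<^sub>0"
    if F0: "finite F\<^sub>0" "F\<^sub>0 \<subseteq> univ N" for F\<^sub>0
  proof -
    obtain F where "finite F" "F\<^sub>0 \<subseteq> F" "F \<subseteq> univ N" "\<forall>q\<in>F\<^sub>0 \<times> F\<^sub>0. S q = (q \<in> T F)"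
      using S[of "F\<^sub>0 \<times> F\<^sub>0" F\<^sub>0] F0 by auto
    then show ?thesis
      using F0 by (intro exI[of _ F]) (auto simp: R_def)
  qed
  have "linear_order_on (univ N) R"
  proof (rule linear_order_on_locallyI)
    show "R \<subseteq> univ N \<times> univ N" by (auto simp: R_def)
    fix F\<^sub>0 assume F0: "finite F\<^sub>0" "F\<^sub>0 \<subseteq> univ N"
    then obtain F where F: "finite F" "F\<^sub>0 \<subseteq> F" "F \<subseteq> univ N" "R \<inter> F\<^sub>0 \<times> F\<^sub>0 = T F \<inter> F\<^sub>0 \<times> F\<^sub>0"
      using approx[OF F0] by blast
    have "linear_order_on F\<^sub>0 (pullback id F\<^sub>0 (T F))"
      using T[OF F(1,3)] F(2) by (intro linear_order_on_pullback) auto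
    moreover have "pullback id F\<^sub>0 (T F) = R \<inter> F\<^sub>0 \<times> F\<^sub>0"
      unfolding F(4) by (auto simp: pullback_def)
    ultimately show "linear_order_on F\<^sub>0 (R \<inter> F\<^sub>0 \<times> F\<^sub>0)" by simp
  qed
  moreover have "qf_invariant_on L N (univ N) R"
    unfolding qf_invariant_on_def
  proof (intro ballI impI)
    fix a b c d assume U: "a \<in> univ N" "b \<in> univ N" "c \<in> univ N" "d \<in> univ N"
      and same: "same_atoms L N (assign a b) N (assign c d)"
    \<comment> \<open>All four points are included so that a single \<open>T F\<close> decides both
      pairs.\<close>
    let ?F0 = "{a, b, c, d}"
    obtain F where F: "finite F" "?F0 \<subseteq> F" "F \<subseteq> univ N" "R \<inter> ?F0 \<times> ?F0 = T F \<inter> ?F0 \<times> ?F0"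
      using approx[of ?F0] U by auto
    have "(a, b) \<in> T F \<longleftrightarrow> (c, d) \<in> T F"
      using T[OF F(1,3)] F(2) same by (simp add: qf_invariant_on_def)
    moreover have "q \<in> R \<longleftrightarrow> q \<in> T F" if "q \<in> ?F0 \<times> ?F0" for q
      using F(4) that by blast
    ultimately show "(a, b) \<in> R \<longleftrightarrow> (c, d) \<in> R" by simp
  qed
  ultimately show ?thesis by blast
qed

section \<open>The defining formula in \<open>N\<close> and in the class\<close>

lemma has_age_embedding:
  assumes "has_age L N C" "B \<in> C" "is_structure L B"
  shows "embeddings L B N \<noteq> {}"
proof -
  obtain A g where A: "substructure L A N" and g: "g \<in> isomorphisms L A B"
    using assms by (fastforce simp: has_age_def isomorphic_def)
  have "is_structure L A"
    using A by (simp add: substructure_def)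
  then show ?thesis
    using compose_embedding[OF assms(3) inverse_embedding[OF _ g] inclusion_embedding[OF A]] by blast
qed

theorem theorem2:
  fixes L :: "('f, 'r) language"
    and C :: "('f, 'r) struct_class"
    and N :: "('a, 'f, 'r) struct"
  assumes "ramsey_class L C"
    and "is_structure L N"
    and "has_age L N C"
  shows "\<exists>R \<Phi>.
    linear_order_on (univ N) R \<and> aut_invariant L N R \<and> union_of_qf_types L N R \<and>
    is_dnf L \<Phi> \<and> R = defined_rel N \<Phi> \<and>
    (\<forall>A\<in>C. linear_order_on (univ A) (defined_rel A \<Phi>))"
proof -
  obtain R where R: "linear_order_on (univ N) R" and "qf_invariant_on L N (univ N) R"
    using age_invariant_order[OF assms] by blast
  then have inv: "(a, b) \<in> R \<longleftrightarrow> (c, d) \<in> R"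
    if "a \<in> univ N" "b \<in> univ N" "c \<in> univ N" "d \<in> univ N"
      "same_atoms L N (assign a b) N (assign c d)" for a b c d
    using that by (simp add: qf_invariant_on_def)
  have RN: "R \<subseteq> univ N \<times> univ N"
    using R by (simp add: order_on_defs)
  \<comment> \<open>There is one disjunct per pair in \<open>R\<close>, namely the conjunction of
    all literals true of that pair.\<close>
  define \<Phi> where "\<Phi> = (\<lambda>(a, b). {\<phi>. literal L \<phi> \<and> qf_sat N (assign a b) \<phi>}) ` R"
  have defined: "defined_rel M \<Phi> = {(c, d) \<in> univ M \<times> univ M.
      \<exists>(a, b)\<in>R. same_atoms L N (assign a b) M (assign c d)}" for M :: "('b, 'f, 'r) struct"
    by (simp add: defined_rel_def \<Phi>_def literals_sat_iff_same_atoms split_beta)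
  \<comment> \<open>Invariance says that \<open>R\<close> is closed under equality of types, so
    \<open>\<Phi>\<close> adds no new pairs in \<open>N\<close>.\<close>
  have R_eq: "R = {(c, d) \<in> univ N \<times> univ N.
      \<exists>(a, b)\<in>R. same_atoms L N (assign a b) N (assign c d)}" (is "R = ?S")
  proof (intro equalityI subrelI)
    have refl: "same_atoms L N s N s" for s :: "xy \<Rightarrow> 'a"
      by (simp add: same_atoms_def)
    show "(c, d) \<in> ?S" if "(c, d) \<in> R" for c d
      using that RN refl by blast
    fix c d assume "(c, d) \<in> ?S"
    then obtain a b where ab: "(a, b) \<in> R" "same_atoms L N (assign a b) N (assign c d)"
      and cd: "c \<in> univ N" "d \<in> univ N"
      by blast
    then show "(c, d) \<in> R"
      using RN inv[OF _ _ cd ab(2)] by blast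
  qed
  have "aut_invariant L N R"
    unfolding aut_invariant_def
  proof (intro ballI)
    fix g a b assume "g \<in> Aut L N" and ab: "a \<in> univ N" "b \<in> univ N"
    then have g: "g \<in> embeddings L N N" by (simp add: isomorphisms_def)
    show "(a, b) \<in> R \<longleftrightarrow> (g a, g b) \<in> R"
      using ab embedding_in[OF g] same_atoms_assign_embedding[OF assms(2) g ab] by (intro inv)
  qed
  moreover have "union_of_qf_types L N R"
    unfolding union_of_qf_types_def
  proof (intro exI conjI)
    \<comment> \<open>Only types realised by pairs in \<open>R\<close> are taken.\<close>
    let ?P = "(\<lambda>(a, b). {\<phi>. wf_qf L \<phi> \<and> qf_sat N (assign a b) \<phi>}) ` R"
    show "\<forall>p\<in>?P. complete_qf_type L N p"
      using RN complete_qf_type_of_pair by fast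
    have "(\<Union>p\<in>?P. realisations N p) =
        {(c, d) \<in> univ N \<times> univ N. \<exists>(a, b)\<in>R. same_atoms L N (assign a b) N (assign c d)}"
      by (auto simp: realisations_type_of_pair intro: rev_bexI)
    then show "R = (\<Union>p\<in>?P. realisations N p)"
      using R_eq by simp
  qed
  moreover have "is_dnf L \<Phi>"
    by (auto simp: is_dnf_def \<Phi>_def)
  moreover have "R = defined_rel N \<Phi>"
    unfolding defined by (rule R_eq)
  moreover have "linear_order_on (univ A) (defined_rel A \<Phi>)" if A: "A \<in> C" for A
  proof -
    have stA: "is_structure L A"
      using ramsey_class_structure[OF assms(1) A] .
    obtain g where g: "g \<in> embeddings L A N"
      using has_age_embedding[OF assms(3) A stA] by blast
    \<comment> \<open>Embeddings preserve types, so \<open>\<Phi>\<close> holds of a pair in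
      \<open>A\<close> exactly when its image under \<open>g\<close> lies in \<open>R\<close>; the
      relation defined in \<open>A\<close> is thus a pullback of a linear order.\<close>
    have "(\<exists>(a, b)\<in>R. same_atoms L N (assign a b) A (assign c d)) \<longleftrightarrow> (g c, g d) \<in> R"
      if cd: "c \<in> univ A" "d \<in> univ A" for c d
    proof -
      have same: "same_atoms L A (assign c d) N (assign (g c) (g d))"
        by (rule same_atoms_assign_embedding[OF stA g cd])
      have gcd: "g c \<in> univ N" "g d \<in> univ N"
        using cd embedding_in[OF g] by auto
      show ?thesis
      proof
        assume "\<exists>(a, b)\<in>R. same_atoms L N (assign a b) A (assign c d)"
        then obtain a b where ab: "(a, b) \<in> R" "same_atoms L N (assign a b) A (assign c d)"
          by blast
        then show "(g c, g d) \<in> R"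
          using inv[of a b "g c" "g d"] RN gcd same_atoms_trans[OF ab(2) same] by auto
      qed (use same_atoms_sym[OF same] in blast)
    qed
    then have "defined_rel A \<Phi> = pullback g (univ A) R"
      unfolding defined pullback_def by auto
    then show ?thesis
      using R embedding_inj[OF g] embedding_in[OF g] by (simp add: linear_order_on_pullback image_subsetI)
  qed
  ultimately show ?thesis
    using R by blast
qed

end
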